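(* Let $f\colon[a,b]\to\mathbb{R}$ be a function of class $C^1$ on $[a,b]$ whose derivative $f'$ has a finite number of zeros in $[a,b]$. Let $g\in C^1[a,b]$ be a function with $g'(t)>0$ for every $t\in[a,b]$. For each positive integer $n$ let $\Delta_{opt}=\Delta_{opt}(n)$ be an optimal $n$-division of $[a,b]$ for the lower Riemann-Stieltjes sum of $f$ with respect to $g$. Then $$\lim_{n\to\infty} n\left(\int_a^b f(t)\,\mathrm{d}g(t)-RS(f,g,\Delta_{opt},\min)\right)=\frac12\left(\int_a^b\sqrt{|f'(t)|\cdot g'(t)}\,\mathrm{d}t\right)^2.$$
   Context: Let $[a,b]$ be a bounded closed interval of real numbers with $a<b$. An $n$-division $\Delta$ of $[a,b]$ is a choice of points $a=t_0<t_1<\dots<t_n=b$. The integral $\int_a^b f(t)\,\mathrm{d}g(t)$ is the Riemann-Stieltjes integral of $f$ with respect to $g$: the number $I\in\mathbb{R}$ such that for every $\varepsilon>0$ there is $\delta>0$ with $\left|\sum_{i=1}^n f(\xi_i)[g(t_i)-g(t_{i-1})]-I\right|<\varepsilon$ for every division $\Delta$ with $\max_{1\le i\le n}(t_i-t_{i-1})<\delta$ and all $\xi_i\in[t_{i-1},t_i]$. The lower Riemann-Stieltjes sum of a continuous function $f$ with respect to $g$ and $\Delta$ is $$RS(f,g,\Delta,\min)=\sum_{i=1}^n\left(\min_{t\in[t_{i-1},t_i]}f(t)\right)[g(t_i)-g(t_{i-1})].$$ For given $n$, an optimal $n$-division $\Delta_{opt}$ is an $n$-division at which $\Delta\mapsto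 RS(f,g,\Delta,\min)$ attains its maximum over all $n$-divisions of $[a,b]$. It may not be unique, but the value $RS(f,g,\Delta_{opt},\min)$ depends only on $f,g,n$. *)

theory Defs
  imports "HOL-Analysis.Analysis"
begin

(* A division is a sequence t of which only the values t 0, ..., t n are relevant. *)
definition division :: "real \<Rightarrow> real \<Rightarrow> nat \<Rightarrow> (nat \<Rightarrow> real) \<Rightarrow> bool" where
  "division a b n t \<longleftrightarrow> t 0 = a \<and> t n = b \<and> (\<forall>i\<in>{1..n}. t (i - 1) < t i)"

definition mesh :: "nat \<Rightarrow> (nat \<Rightarrow> real) \<Rightarrow> real" where
  "mesh n t = Max ((\<lambda>i. t i - t (i - 1)) ` {1..n})"

definition has_RS_integral ::
    "(real \<Rightarrow> real) \<Rightarrow> (real \<Rightarrow> real) \<Rightarrow> real \<Rightarrow> real \<Rightarrow> real \<Rightarrow> bool" where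
  "has_RS_integral f g a b I \<longleftrightarrow>
     (\<forall>\<epsilon>>0. \<exists>\<delta>>0. \<forall>n t \<xi>.
        division a b n t \<and> mesh n t < \<delta> \<and> (\<forall>i\<in>{1..n}. \<xi> i \<in> {t (i - 1)..t i}) \<longrightarrow>
        \<bar>(\<Sum>i=1..n. f (\<xi> i) * (g (t i) - g (t (i - 1)))) - I\<bar> < \<epsilon>)"

definition RS_integral :: "(real \<Rightarrow> real) \<Rightarrow> (real \<Rightarrow> real) \<Rightarrow> real \<Rightarrow> real \<Rightarrow> real" where
  "RS_integral f g a b = (THE I. has_RS_integral f g a b I)"

(* LEAST picks the minimum of f on the subinterval, which exists when f is continuous. *)
definition lower_RS_sum ::
    "(real \<Rightarrow> real) \<Rightarrow> (real \<Rightarrow> real) \<Rightarrow> nat \<Rightarrow> (nat \<Rightarrow> real) \<Rightarrow> real" where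
  "lower_RS_sum f g n t =
     (\<Sum>i=1..n. (LEAST y. y \<in> f ` {t (i - 1)..t i}) * (g (t i) - g (t (i - 1))))"

definition optimal_division ::
    "(real \<Rightarrow> real) \<Rightarrow> (real \<Rightarrow> real) \<Rightarrow> real \<Rightarrow> real \<Rightarrow> nat \<Rightarrow> (nat \<Rightarrow> real) \<Rightarrow> bool" where
  "optimal_division f g a b n t \<longleftrightarrow>
     division a b n t \<and>
     (\<forall>s. division a b n s \<longrightarrow> lower_RS_sum f g n s \<le> lower_RS_sum f g n t)"

end

theory Submission
  imports Defs "HOL-Real_Asymp.Real_Asymp"
begin

text \<open>
  On a cell \<open>[u, v]\<close> the error of the lower sum is the integral of \<open>(f - min f) g'\<close>. Writing \<open>h\<close> for
  the square root of \<open>|f'| g'\<close> and \<open>w\<close> for its integral over the cell, uniform continuity gives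
  \<open>(w - \<eta> (v - u))\<^sup>2 \<le> 2 error \<le> (w + \<eta> (v - u))\<^sup>2\<close> on short cells (the left inequality when the base is
  nonnegative); near a zero of \<open>f'\<close> the left base is not positive, so such cells cost nothing.
  Choosing cells on which \<open>h + \<eta>\<close> has equal integrals yields the upper bound. For the lower bound,
  a long cell is cut into short ones, over which the error is superadditive; Cauchy-Schwarz then
  applies with \<open>n + O(1)\<close> pieces instead of \<open>n\<close>.
\<close>

section \<open>Divisions and sums over their cells\<close>

lemma division_mono:
  assumes "division a b n t" "i \<le> j" "j \<le> n"
  shows "t i \<le> t j"
  using assms(2,3)
proof (induction j rule: dec_induct)
  case (step m)
  have "t (Suc m - 1) < t (Suc m)"
    using assms(1) step.prems unfolding division_def by (elim conjE ballE[of _ _ "Suc m"]) auto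
  with step show ?case by simp
qed simp

lemma division_cell:
  assumes "division a b n t" "i \<in> {1..n}"
  shows "a \<le> t (i - 1)" "t (i - 1) < t i" "t i \<le> b"
proof -
  have "t 0 = a" "t n = b" using assms(1) by (auto simp: division_def)
  then show "a \<le> t (i - 1)" "t i \<le> b"
    using division_mono[OF assms(1), of 0 "i - 1"] division_mono[OF assms(1), of i n] assms(2)
    by auto
  show "t (i - 1) < t i" using assms by (auto simp: division_def)
qed

text \<open>Telescoping by induction on initial segments of the division. The abstract
  \<open>F\<close> covers integrals of continuous functions, increments of \<open>g\<close> and cell
  widths alike.\<close>

lemma sum_division_additive:
  fixes F :: "real \<Rightarrow> real \<Rightarrow> real"
  assumes d: "division a b n t"
    and diag: "F a a = 0"
    and add: "\<And>u v w. \<lbrakk>a \<le> u; u \<le> v; v \<le> w; w \<le> b\<rbrakk> \<Longrightarrow> F u w = F u v + F v w"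
  shows "(\<Sum>i=1..n. F (t (i - 1)) (t i)) = F a b"
proof -
  have t0: "t 0 = a" and tn: "t n = b" using d by (auto simp: division_def)
  have "(\<Sum>i=1..k. F (t (i - 1)) (t i)) = F a (t k)" if "k \<le> n" for k
    using that
  proof (induction k)
    case (Suc k)
    have "a \<le> t k" "t k \<le> t (Suc k)" "t (Suc k) \<le> b"
      using division_mono[OF d, of 0 k] division_mono[OF d, of k "Suc k"]
        division_mono[OF d, of "Suc k" n] Suc.prems t0 tn by auto
    then show ?case using Suc add[of a "t k" "t (Suc k)"] by simp
  qed (simp add: t0 diag)
  from this[of n] tn show ?thesis by simp
qed

lemma division_width_less:
  assumes "division a b n t" "mesh n t < \<delta>" "i \<in> {1..n}"
  shows "t i - t (i - 1) < \<delta>"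
proof -
  have "t i - t (i - 1) \<le> mesh n t"
    unfolding mesh_def using assms(3) by (intro Max_ge) auto
  with assms(2) show ?thesis by simp
qed

text \<open>Equal cells suffice. The lemma shows that the condition in
  \<open>has_RS_integral\<close> is never vacuous, on which uniqueness of the integral
  rests.\<close>

lemma exists_fine_division:
  fixes a b \<delta> :: real
  assumes "a < b" "\<delta> > 0"
  obtains n t where "division a b n t" "mesh n t < \<delta>"
proof -
  obtain m :: nat where m: "(b - a) / \<delta> < real m" using reals_Archimedean2 by blast
  define n where "n = Suc m"
  define t where "t i = a + real i * ((b - a) / real n)" for i
  have w: "t i - t (i - 1) = (b - a) / real n" if "i \<in> {1..n}" for i
    using that by (cases i) (auto simp: t_def distrib_right add_divide_distrib)
  have n: "(b - a) / \<delta> < real n" "n > 0" using m by (auto simp: n_def)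
  have "division a b n t"
    unfolding division_def
  proof (intro conjI ballI)
    fix i assume "i \<in> {1..n}"
    moreover have "(b - a) / real n > 0" using assms n by simp
    ultimately show "t (i - 1) < t i" using w by fastforce
  qed (use n in \<open>auto simp: t_def\<close>)
  moreover have "mesh n t < \<delta>"
  proof -
    have "(\<lambda>i. t i - t (i - 1)) ` {1..n} = {(b - a) / real n}"
      using w n(2) by (subst image_cong[OF refl w]) (auto simp: image_constant_conv)
    then show ?thesis
      unfolding mesh_def using n assms by (simp add: field_simps)
  qed
  ultimately show ?thesis by (rule that)
qed

section \<open>Integrals of linear functions and of distances\<close>

lemma integral_linear_from_endpoint:
  fixes u v C :: real
  assumes "u \<le> v"
  shows "((\<lambda>s. C * (s - u)) has_integral C * (v - u)\<^sup>2 / 2) {u..v}"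
    and "((\<lambda>s. C * (v - s)) has_integral C * (v - u)\<^sup>2 / 2) {u..v}"
proof -
  have "((\<lambda>s. C * (s - u)) has_integral C * (v - u)\<^sup>2 / 2 - C * (u - u)\<^sup>2 / 2) {u..v}"
    using assms
    by (intro fundamental_theorem_of_calculus)
      (auto intro!: derivative_eq_intros simp: field_simps has_real_derivative_iff_has_vector_derivative[symmetric])
  then show "((\<lambda>s. C * (s - u)) has_integral C * (v - u)\<^sup>2 / 2) {u..v}" by simp
  have "((\<lambda>s. C * (v - s)) has_integral (- C * (v - v)\<^sup>2 / 2) - (- C * (v - u)\<^sup>2 / 2)) {u..v}"
    using assms
    by (intro fundamental_theorem_of_calculus)
      (auto intro!: derivative_eq_intros simp: field_simps has_real_derivative_iff_has_vector_derivative[symmetric])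
  then show "((\<lambda>s. C * (v - s)) has_integral C * (v - u)\<^sup>2 / 2) {u..v}" by simp
qed

text \<open>Splitting at \<open>x\<close> gives \<open>C / 2\<close> times the sum of the squares of
  the two lengths. The square of the full length exceeds that sum by a nonnegative cross term, so
  the worst \<open>x\<close> is an endpoint.\<close>

lemma integral_abs_diff_le:
  fixes u v x C :: real
  assumes "x \<in> {u..v}" "C \<ge> 0"
  shows "(\<lambda>s. C * \<bar>s - x\<bar>) integrable_on {u..v}"
    and "integral {u..v} (\<lambda>s. C * \<bar>s - x\<bar>) \<le> C * (v - u)\<^sup>2 / 2"
proof -
  have 1: "((\<lambda>s. C * \<bar>s - x\<bar>) has_integral C * (x - u)\<^sup>2 / 2) {u..x}"
    by (rule has_integral_eq[OF _ integral_linear_from_endpoint(2)]) (use assms in auto)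
  have 2: "((\<lambda>s. C * \<bar>s - x\<bar>) has_integral C * (v - x)\<^sup>2 / 2) {x..v}"
    by (rule has_integral_eq[OF _ integral_linear_from_endpoint(1)]) (use assms in auto)
  have 3: "((\<lambda>s. C * \<bar>s - x\<bar>) has_integral C * (x - u)\<^sup>2 / 2 + C * (v - x)\<^sup>2 / 2) {u..v}"
    using has_integral_combine[OF _ _ 1 2] assms by auto
  then show "(\<lambda>s. C * \<bar>s - x\<bar>) integrable_on {u..v}" by blast
  have "(v - u)\<^sup>2 - ((x - u)\<^sup>2 + (v - x)\<^sup>2) = 2 * ((x - u) * (v - x))"
    by (simp add: power2_eq_square algebra_simps)
  then have "(x - u)\<^sup>2 + (v - x)\<^sup>2 \<le> (v - u)\<^sup>2"
    using assms(1) mult_nonneg_nonneg[of "x - u" "v - x"]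
    unfolding atLeastAtMost_iff by linarith
  then have "C * ((x - u)\<^sup>2 + (v - x)\<^sup>2) \<le> C * (v - u)\<^sup>2"
    using assms(2) by (rule mult_left_mono)
  then show "integral {u..v} (\<lambda>s. C * \<bar>s - x\<bar>) \<le> C * (v - u)\<^sup>2 / 2"
    using integral_unique[OF 3] by (simp add: algebra_simps)
qed

section \<open>The setting and the error on a single cell\<close>

locale C1_pair =
  fixes a b :: real and f f' g g' :: "real \<Rightarrow> real"
  assumes a_less_b: "a < b"
    and f_deriv: "\<And>x. x \<in> {a..b} \<Longrightarrow> (f has_real_derivative f' x) (at x within {a..b})"
    and f'_cont: "continuous_on {a..b} f'"
    and g_deriv: "\<And>x. x \<in> {a..b} \<Longrightarrow> (g has_real_derivative g' x) (at x within {a..b})"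
    and g'_cont: "continuous_on {a..b} g'"
    and g'_pos: "\<And>x. x \<in> {a..b} \<Longrightarrow> g' x > 0"
begin

definition cell_min :: "real \<Rightarrow> real \<Rightarrow> real" where
  "cell_min u v = (LEAST y. y \<in> f ` {u..v})"

text \<open>The Stieltjes integral enters as an ordinary integral with weight \<open>g'\<close>, so
  cells can be estimated before \<open>RS_integral_eq\<close> identifies the two.\<close>

definition gap :: "real \<Rightarrow> real \<Rightarrow> real" where
  "gap u v = integral {u..v} (\<lambda>s. f s * g' s) - cell_min u v * (g v - g u)"

definition h :: "real \<Rightarrow> real" where
  "h x = sqrt (\<bar>f' x\<bar> * g' x)"

lemma f_cont: "continuous_on {a..b} f"
  using f_deriv by (meson DERIV_continuous continuous_on_eq_continuous_within)

lemma h_cont: "continuous_on {a..b} h"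
  unfolding h_def[abs_def] by (intro continuous_intros f'_cont g'_cont)

lemma h_nonneg: "x \<in> {a..b} \<Longrightarrow> h x \<ge> 0"
  using g'_pos[of x] by (simp add: h_def)

lemma integrable_cell:
  fixes F :: "real \<Rightarrow> real"
  assumes "continuous_on {a..b} F" "a \<le> u" "v \<le> b"
  shows "F integrable_on {u..v}"
  using assms by (intro integrable_continuous_real) (auto elim: continuous_on_subset)

lemma integral_cells:
  fixes F :: "real \<Rightarrow> real"
  assumes "continuous_on {a..b} F" "a \<le> u" "u \<le> v" "v \<le> w" "w \<le> b"
  shows "integral {u..w} F = integral {u..v} F + integral {v..w} F"
  using assms integrable_cell[OF assms(1), of u w]
  by (simp add: Henstock_Kurzweil_Integration.integral_combine)

lemma g'_integral:
  assumes "a \<le> u" "u \<le> v" "v \<le> b"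
  shows "(g' has_integral g v - g u) {u..v}"
proof (rule fundamental_theorem_of_calculus[OF assms(2)])
  fix x assume "x \<in> {u..v}"
  then have "(g has_real_derivative g' x) (at x within {u..v})"
    using assms by (intro DERIV_subset[OF g_deriv]) auto
  then show "(g has_vector_derivative g' x) (at x within {u..v})"
    by (simp add: has_real_derivative_iff_has_vector_derivative)
qed

lemma g_mono:
  assumes "a \<le> u" "u \<le> v" "v \<le> b"
  shows "g u \<le> g v"
proof -
  have "0 \<le> g v - g u"
    using g'_pos assms by (intro has_integral_nonneg[OF g'_integral[OF assms]]) (force intro: less_imp_le)
  then show ?thesis by simp
qed

lemma cell_min_attained:
  assumes "a \<le> u" "u \<le> v" "v \<le> b"
  obtains x where "x \<in> {u..v}" "cell_min u v = f x" "\<And>y. y \<in> {u..v} \<Longrightarrow> f x \<le> f y"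
proof -
  have "continuous_on {u..v} f" using f_cont assms by (auto elim: continuous_on_subset)
  then obtain x where x: "x \<in> {u..v}" "\<And>y. y \<in> {u..v} \<Longrightarrow> f x \<le> f y"
    using continuous_attains_inf[of "{u..v}" f] assms by auto
  moreover have "cell_min u v = f x"
    unfolding cell_min_def using x by (intro Least_equality) auto
  ultimately show ?thesis using that by blast
qed

lemma cell_min_le:
  assumes "a \<le> u" "v \<le> b" "x \<in> {u..v}"
  shows "cell_min u v \<le> f x"
  using cell_min_attained[of u v] assms by (metis atLeastAtMost_iff order_trans)

text \<open>The increment of \<open>g\<close> is the integral of \<open>g'\<close>, so the constant
  minimum moves under the integral. Pointwise bounds on the integrand then become bounds on the
  gap.\<close>

lemma gap_integral:
  assumes "a \<le> u" "u \<le> v" "v \<le> b"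
  shows "((\<lambda>s. (f s - cell_min u v) * g' s) has_integral gap u v) {u..v}"
proof -
  have "(\<lambda>s. f s * g' s) integrable_on {u..v}"
    using assms by (intro integrable_cell continuous_intros f_cont g'_cont)
  then have "((\<lambda>s. f s * g' s - cell_min u v * g' s) has_integral gap u v) {u..v}"
    unfolding gap_def
    by (intro has_integral_diff has_integral_mult_right g'_integral assms integrable_integral)
  then show ?thesis by (simp add: algebra_simps)
qed

lemma gap_nonneg:
  assumes "a \<le> u" "u \<le> v" "v \<le> b"
  shows "gap u v \<ge> 0"
proof (rule has_integral_nonneg[OF gap_integral[OF assms]])
  fix s assume "s \<in> {u..v}"
  then show "0 \<le> (f s - cell_min u v) * g' s"
    using cell_min_le[of u v s] g'_pos[of s] assms by (intro mult_nonneg_nonneg) auto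
qed

text \<open>Cutting a cell leaves the integral unchanged and can only raise the minima, which are
  weighted by nonnegative increments of \<open>g\<close>.\<close>

lemma gap_superadditive:
  assumes "a \<le> u" "u \<le> v" "v \<le> w" "w \<le> b"
  shows "gap u v + gap v w \<le> gap u w"
proof -
  have le: "cell_min u w \<le> cell_min u v" "cell_min u w \<le> cell_min v w"
    using cell_min_attained[of u v] cell_min_attained[of v w] cell_min_le[of u w] assms
    by (metis atLeastAtMost_iff order_trans)+
  have "cell_min u w * (g v - g u) \<le> cell_min u v * (g v - g u)"
    "cell_min u w * (g w - g v) \<le> cell_min v w * (g w - g v)"
    using le g_mono assms by (auto intro!: mult_right_mono)
  moreover have "integral {u..w} (\<lambda>s. f s * g' s) =
      integral {u..v} (\<lambda>s. f s * g' s) + integral {v..w} (\<lambda>s. f s * g' s)"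
    using assms by (intro integral_cells continuous_intros f_cont g'_cont)
  ultimately show ?thesis by (simp add: gap_def algebra_simps)
qed

section \<open>Bounds for the gap in terms of \<open>f'\<close> and \<open>g'\<close>\<close>

lemma f_mvt:
  assumes "a \<le> x" "x < y" "y \<le> b"
  obtains z where "x < z" "z < y" "f y - f x = (y - x) * f' z"
proof -
  have "continuous_on {x..y} f" using f_cont assms by (auto elim: continuous_on_subset)
  moreover have "(f has_real_derivative f' z) (at z)" if "x < z" "z < y" for z
    using f_deriv[of z] that assms by (simp add: at_within_Icc_at)
  ultimately obtain l z where "z > x" "z < y" "(f has_real_derivative l) (at z)" "f y - f x = (y - x) * l"
    using MVT[OF assms(2), of f] by (metis real_differentiable_def)
  moreover have "l = f' z"
    using DERIV_unique \<open>(f has_real_derivative l) (at z)\<close>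
      \<open>\<And>z. \<lbrakk>x < z; z < y\<rbrakk> \<Longrightarrow> (f has_real_derivative f' z) (at z)\<close> calculation by blast
  ultimately show ?thesis using that by blast
qed

text \<open>By the mean value theorem \<open>f\<close> exceeds its minimum, attained at some
  \<open>x\<close>, by at most \<open>A * \<bar>s - x\<bar>\<close>. Integrating against
  \<open>g' \<le> B\<close> reduces the claim to \<open>integral_abs_diff_le\<close>.\<close>

lemma gap_le:
  assumes uv: "a \<le> u" "u \<le> v" "v \<le> b"
    and A: "\<And>x. x \<in> {u..v} \<Longrightarrow> \<bar>f' x\<bar> \<le> A"
    and B: "\<And>x. x \<in> {u..v} \<Longrightarrow> g' x \<le> B"
  shows "gap u v \<le> A * B * (v - u)\<^sup>2 / 2"
proof -
  obtain x where x: "x \<in> {u..v}" "cell_min u v = f x" "\<And>y. y \<in> {u..v} \<Longrightarrow> f x \<le> f y"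
    using cell_min_attained[OF uv] by blast
  have A0: "A \<ge> 0" using A[OF x(1)] by simp
  have B0: "B \<ge> 0" using B[OF x(1)] g'_pos[of x] x(1) uv by force
  have lip: "f s - f x \<le> A * \<bar>s - x\<bar>" if s: "s \<in> {u..v}" for s
  proof -
    have *: "\<bar>f q - f p\<bar> \<le> A * (q - p)" if pq: "p < q" "p \<in> {u..v}" "q \<in> {u..v}" for p q
    proof -
      obtain z where z: "p < z" "z < q" "f q - f p = (q - p) * f' z"
        using f_mvt[of p q] pq uv by auto
      have "\<bar>f' z\<bar> * (q - p) \<le> A * (q - p)" using A[of z] z that by (intro mult_right_mono) auto
      then show ?thesis using z that by (simp add: abs_mult mult.commute)
    qed
    consider "s < x" | "s = x" | "x < s" by linarith
    then show ?thesis using *[of s x] *[of x s] s x(1) by cases auto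
  qed
  have "gap u v \<le> integral {u..v} (\<lambda>s. (A * B) * \<bar>s - x\<bar>)"
  proof (rule has_integral_le[OF gap_integral[OF uv] integrable_integral])
    show "(\<lambda>s. (A * B) * \<bar>s - x\<bar>) integrable_on {u..v}"
      using A0 B0 x(1) by (intro integral_abs_diff_le) auto
    fix s assume s: "s \<in> {u..v}"
    have "(f s - cell_min u v) * g' s \<le> (A * \<bar>s - x\<bar>) * B"
      using lip[OF s] B[OF s] x(2,3) s g'_pos[of s] uv A0 B0
      by (intro mult_mono) (auto intro: less_imp_le)
    then show "(f s - cell_min u v) * g' s \<le> (A * B) * \<bar>s - x\<bar>" by (simp add: ac_simps)
  qed
  also have "\<dots> \<le> A * B * (v - u)\<^sup>2 / 2"
    using A0 B0 x(1) by (intro integral_abs_diff_le) auto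
  finally show ?thesis .
qed

text \<open>A continuous derivative without zeros keeps its sign, so \<open>f\<close> is monotone on
  the cell and rises at rate at least \<open>A\<close> away from its lower endpoint:
  \<open>u\<close> if increasing, \<open>v\<close> if decreasing.\<close>

lemma gap_ge:
  assumes uv: "a \<le> u" "u \<le> v" "v \<le> b"
    and nz: "\<And>x. x \<in> {u..v} \<Longrightarrow> f' x \<noteq> 0"
    and A: "\<And>x. x \<in> {u..v} \<Longrightarrow> A \<le> \<bar>f' x\<bar>" "A \<ge> 0"
    and B: "\<And>x. x \<in> {u..v} \<Longrightarrow> B \<le> g' x" "B \<ge> 0"
  shows "A * B * (v - u)\<^sup>2 / 2 \<le> gap u v"
proof -
  have f'c: "continuous_on {u..v} f'" using f'_cont uv by (auto elim: continuous_on_subset)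
  have conn: "connected (f' ` {u..v})" by (intro connected_continuous_image f'c) auto
  \<comment> \<open>Otherwise there are points with \<open>f' \<le> 0\<close> and with
    \<open>f' \<ge> 0\<close>, and the connected image would contain 0.\<close>
  have sign: "(\<forall>x\<in>{u..v}. f' x > 0) \<or> (\<forall>x\<in>{u..v}. f' x < 0)"
  proof (rule ccontr)
    assume "\<not> ?thesis"
    then obtain p q where pq: "p \<in> {u..v}" "q \<in> {u..v}" "f' p \<le> 0" "f' q \<ge> 0" by force
    then have "0 \<in> f' ` {u..v}"
      using conn unfolding connected_iff_interval by blast
    with nz show False by auto
  qed
  then consider (pos) "\<And>x. x \<in> {u..v} \<Longrightarrow> f' x > 0" | (neg) "\<And>x. x \<in> {u..v} \<Longrightarrow> f' x < 0" by blast
  then show ?thesis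
  proof cases
    case pos
    show ?thesis
    proof (rule has_integral_le[OF integral_linear_from_endpoint(1)[OF uv(2)] gap_integral[OF uv]])
      fix s assume s: "s \<in> {u..v}"
      have "A * (s - u) \<le> f s - f u"
      proof (cases "s = u")
        case False
        then obtain z where z: "u < z" "z < s" "f s - f u = (s - u) * f' z"
          using f_mvt[of u s] s uv by auto
        have "A * (s - u) \<le> f' z * (s - u)"
          using A(1)[of z] pos[of z] z s by (intro mult_right_mono) auto
        with z show ?thesis by (simp add: mult.commute)
      qed simp
      also have "\<dots> \<le> f s - cell_min u v" using cell_min_le[of u v u] uv by simp
      finally have "(A * (s - u)) * B \<le> (f s - cell_min u v) * g' s"
        using B(1)[OF s] B(2) A(2) s cell_min_le[of u v s] uv by (intro mult_mono) auto
      then show "A * B * (s - u) \<le> (f s - cell_min u v) * g' s" by (simp add: ac_simps)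
    qed
  next
    case neg
    show ?thesis
    proof (rule has_integral_le[OF integral_linear_from_endpoint(2)[OF uv(2)] gap_integral[OF uv]])
      fix s assume s: "s \<in> {u..v}"
      have "A * (v - s) \<le> f s - f v"
      proof (cases "s = v")
        case False
        then obtain z where z: "s < z" "z < v" "f v - f s = (v - s) * f' z"
          using f_mvt[of s v] s uv by auto
        have "A * (v - s) \<le> - f' z * (v - s)"
          using A(1)[of z] neg[of z] z s by (intro mult_right_mono) auto
        with z show ?thesis by (simp add: algebra_simps)
      qed simp
      also have "\<dots> \<le> f s - cell_min u v" using cell_min_le[of u v v] uv by simp
      finally have "(A * (v - s)) * B \<le> (f s - cell_min u v) * g' s"
        using B(1)[OF s] B(2) A(2) s cell_min_le[of u v s] uv by (intro mult_mono) auto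
      then show "A * B * (v - s) \<le> (f s - cell_min u v) * g' s" by (simp add: ac_simps)
    qed
  qed
qed

section \<open>The gap compared with the integral of \<open>h\<close>\<close>

text \<open>The extrema of \<open>|f'|\<close> and \<open>g'\<close> on the cell are fed into
  \<open>gap_le\<close> and \<open>gap_ge\<close>. On short cells the root of their product differs
  from \<open>h\<close> by less than \<open>\<eta>\<close>; integration turns this into
  \<open>\<eta> * (v - u)\<close>. The truncation at 0 allows the lower estimate to be
  squared.\<close>

lemma gap_short_cell:
  assumes "\<eta> > 0"
  obtains \<delta> where "\<delta> > 0"
    "\<And>u v. \<lbrakk>a \<le> u; u \<le> v; v \<le> b; v - u \<le> \<delta>\<rbrakk> \<Longrightarrow>
       2 * gap u v \<le> (integral {u..v} h + \<eta> * (v - u))\<^sup>2"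
    "\<And>u v. \<lbrakk>a \<le> u; u \<le> v; v \<le> b; v - u \<le> \<delta>\<rbrakk> \<Longrightarrow>
       (max 0 (integral {u..v} h - \<eta> * (v - u)))\<^sup>2 \<le> 2 * gap u v"
proof -
  \<comment> \<open>decoupling the arguments compares the product of the separate extrema of \<open>|f'|\<close> and \<open>g'\<close> with \<open>h\<^sup>2\<close>\<close>
  define F where "F p = sqrt (\<bar>f' (fst p)\<bar> * g' (snd p))" for p :: "real \<times> real"
  have "continuous_on ({a..b} \<times> {a..b}) F"
    unfolding F_def[abs_def]
    by (intro continuous_intros continuous_on_compose2[OF f'_cont] continuous_on_compose2[OF g'_cont]) auto
  then have "uniformly_continuous_on ({a..b} \<times> {a..b}) F"
    by (intro compact_uniformly_continuous compact_Times) auto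
  then obtain d where d: "d > 0" and
    dF: "\<And>p q. \<lbrakk>p \<in> {a..b} \<times> {a..b}; q \<in> {a..b} \<times> {a..b}; dist q p < d\<rbrakk> \<Longrightarrow> dist (F q) (F p) < \<eta>"
    using assms unfolding uniformly_continuous_on_def by metis
  have near: "\<bar>F (r, s) - h x\<bar> < \<eta>"
    if "a \<le> u" "v \<le> b" "v - u \<le> d / 3" "r \<in> {u..v}" "s \<in> {u..v}" "x \<in> {u..v}" for u v r s x
  proof -
    \<comment> \<open>Each coordinate contributes at most \<open>d / 3\<close>, so the two together
      stay below \<open>d\<close>.\<close>
    have "dist (r, s) (x, x) \<le> \<bar>r - x\<bar> + \<bar>s - x\<bar>"
      unfolding dist_Pair_Pair dist_real_def by (rule sqrt_sum_squares_le_sum_abs[THEN order_trans]) simp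
    also have "\<dots> < d" using that d by auto
    finally show ?thesis
      using dF[of "(x, x)" "(r, s)"] that by (auto simp: F_def h_def dist_real_def)
  qed
  have int_const: "((\<lambda>x. c) has_integral c * (v - u)) {u..v}" if "u \<le> v" for c u v :: real
    using has_integral_const_real[of c u v] that by (simp add: mult.commute)
  have h_int: "(h has_integral integral {u..v} h) {u..v}" if "a \<le> u" "v \<le> b" for u v
    using integrable_cell[OF h_cont that] by blast
  have extreme: "\<exists>p\<in>{u..v}. \<forall>x\<in>{u..v}. k p \<le> k x" "\<exists>p\<in>{u..v}. \<forall>x\<in>{u..v}. k x \<le> k p"
    if "continuous_on {a..b} k" "a \<le> u" "u \<le> v" "v \<le> b" for u v and k :: "real \<Rightarrow> real"
  proof -
    have "continuous_on {u..v} k" using that by (auto elim: continuous_on_subset)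
    then show "\<exists>p\<in>{u..v}. \<forall>x\<in>{u..v}. k p \<le> k x" "\<exists>p\<in>{u..v}. \<forall>x\<in>{u..v}. k x \<le> k p"
      using continuous_attains_inf[of "{u..v}" k] continuous_attains_sup[of "{u..v}" k] that by auto
  qed
  have abs_f'_cont: "continuous_on {a..b} (\<lambda>x. \<bar>f' x\<bar>)" by (intro continuous_intros f'_cont)
  show ?thesis
  proof (rule that[of "d / 3"])
    show "d / 3 > 0" using d by simp
    fix u v assume uv: "a \<le> u" "u \<le> v" "v \<le> b" "v - u \<le> d / 3"
    note ext_f = extreme[OF abs_f'_cont uv(1-3)] and ext_g = extreme[OF g'_cont uv(1-3)]
    obtain r s where r: "r \<in> {u..v}" "\<And>x. x \<in> {u..v} \<Longrightarrow> \<bar>f' x\<bar> \<le> \<bar>f' r\<bar>"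
      and s: "s \<in> {u..v}" "\<And>x. x \<in> {u..v} \<Longrightarrow> g' x \<le> g' s"
      using ext_f(2) ext_g(2) by blast
    have F0: "F (p, q) \<ge> 0" "(F (p, q))\<^sup>2 = \<bar>f' p\<bar> * g' q" if "q \<in> {u..v}" for p q
      using g'_pos[of q] that uv by (auto simp: F_def)
    have "2 * gap u v \<le> (F (r, s) * (v - u))\<^sup>2"
      using gap_le[OF uv(1-3) r(2) s(2)] F0[OF s(1)] by (simp add: power_mult_distrib)
    also have "F (r, s) * (v - u) \<le> integral {u..v} h + \<eta> * (v - u)"
    proof (rule has_integral_le[OF int_const has_integral_add[OF h_int int_const]])
      fix x assume "x \<in> {u..v}"
      then show "F (r, s) \<le> h x + \<eta>" using near[OF uv(1,3,4) r(1) s(1)] by force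
    qed (use uv in auto)
    then have "(F (r, s) * (v - u))\<^sup>2 \<le> (integral {u..v} h + \<eta> * (v - u))\<^sup>2"
      using F0[OF s(1)] uv by (intro power_mono mult_nonneg_nonneg) auto
    finally show "2 * gap u v \<le> (integral {u..v} h + \<eta> * (v - u))\<^sup>2" .
  next
    fix u v assume uv: "a \<le> u" "u \<le> v" "v \<le> b" "v - u \<le> d / 3"
    note ext_f = extreme[OF abs_f'_cont uv(1-3)] and ext_g = extreme[OF g'_cont uv(1-3)]
    obtain r s where r: "r \<in> {u..v}" "\<And>x. x \<in> {u..v} \<Longrightarrow> \<bar>f' r\<bar> \<le> \<bar>f' x\<bar>"
      and s: "s \<in> {u..v}" "\<And>x. x \<in> {u..v} \<Longrightarrow> g' s \<le> g' x"
      using ext_f(1) ext_g(1) by blast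
    have F0: "F (p, q) \<ge> 0" "(F (p, q))\<^sup>2 = \<bar>f' p\<bar> * g' q" if "q \<in> {u..v}" for p q
      using g'_pos[of q] that uv by (auto simp: F_def)
    have w: "integral {u..v} h - \<eta> * (v - u) \<le> F (r, s) * (v - u)"
    proof (rule has_integral_le[OF has_integral_diff[OF h_int int_const] int_const])
      fix x assume "x \<in> {u..v}"
      then show "h x - \<eta> \<le> F (r, s)" using near[OF uv(1,3,4) r(1) s(1)] by force
    qed (use uv in auto)
    have "max 0 (integral {u..v} h - \<eta> * (v - u)) \<le> F (r, s) * (v - u)"
      using w F0[OF s(1)] uv by auto
    then have "(max 0 (integral {u..v} h - \<eta> * (v - u)))\<^sup>2 \<le> (F (r, s) * (v - u))\<^sup>2"
      by (intro power_mono) auto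
    \<comment> \<open>As \<open>r\<close> minimizes \<open>|f'|\<close>, either
      \<open>f' r = 0\<close> and the left side vanishes, or \<open>f'\<close> has no zero on the
      cell and \<open>gap_ge\<close> applies.\<close>
    also have "\<dots> \<le> 2 * gap u v"
    proof (cases "f' r = 0")
      case True
      then show ?thesis using gap_nonneg[OF uv(1-3)] by (simp add: F_def)
    next
      case False
      have "f' x \<noteq> 0" if "x \<in> {u..v}" for x using r(2)[OF that] False by auto
      then have "\<bar>f' r\<bar> * g' s * (v - u)\<^sup>2 / 2 \<le> gap u v"
        using r s g'_pos[of s] uv by (intro gap_ge) auto
      then show ?thesis using F0[OF s(1)] by (simp add: power_mult_distrib)
    qed
    finally show "(max 0 (integral {u..v} h - \<eta> * (v - u)))\<^sup>2 \<le> 2 * gap u v" .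
  qed
qed

text \<open>An arbitrary division may contain long cells. Cutting such a cell into pieces of length
  at most \<open>\<delta>\<close> does not increase the total gap, and Cauchy-Schwarz costs a factor
  equal to the number of pieces. Bounding that number by \<open>1 + (v - u) / \<delta>\<close> gives
  a factor that sums well over a division.\<close>

lemma gap_long_cell:
  assumes \<delta>: "\<delta> > 0"
    and short: "\<And>u v. \<lbrakk>a \<le> u; u \<le> v; v \<le> b; v - u \<le> \<delta>\<rbrakk> \<Longrightarrow>
       (max 0 (integral {u..v} h - \<eta> * (v - u)))\<^sup>2 \<le> 2 * gap u v"
    and uv: "a \<le> u" "u \<le> v" "v \<le> b"
  shows "(max 0 (integral {u..v} h - \<eta> * (v - u)))\<^sup>2 \<le> (1 + (v - u) / \<delta>) * (2 * gap u v)"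
proof -
  define \<phi> where "\<phi> u v = integral {u..v} h - \<eta> * (v - u)" for u v
  \<comment> \<open>\<open>Suc k\<close> bounds the number of pieces; being positive, it can be
    divided by in the induction step.\<close>
  have *: "(max 0 (\<phi> u v))\<^sup>2 \<le> real (Suc k) * (2 * gap u v)"
    if "v - u \<le> real (Suc k) * \<delta>" "a \<le> u" "u \<le> v" "v \<le> b" for u v k
    using that
  proof (induction k arbitrary: v)
    case 0
    then show ?case using short[of u v] by (simp add: \<phi>_def)
  next
    case (Suc k)
    \<comment> \<open>The last piece is cut off. The maximum keeps the cut inside the cell: if the
      cell is already short, the first part degenerates to a point.\<close>
    define m where "m = max u (v - \<delta>)"
    have m: "u \<le> m" "m \<le> v" "v - m \<le> \<delta>" "m - u \<le> real (Suc k) * \<delta>"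
      using Suc.prems \<delta> by (auto simp: m_def algebra_simps)
    let ?x = "max 0 (\<phi> u m)" and ?y = "max 0 (\<phi> m v)" and ?K = "real (Suc k)"
    have "\<phi> u v = \<phi> u m + \<phi> m v"
      using integral_cells[OF h_cont, of u m v] m Suc.prems by (simp add: \<phi>_def algebra_simps)
    then have "(max 0 (\<phi> u v))\<^sup>2 \<le> (?x + ?y)\<^sup>2" by (intro power_mono) auto
    \<comment> \<open>Cauchy-Schwarz with weights \<open>?K\<close> and 1, for the earlier pieces
      and the last one; the defect is a square divided by \<open>?K\<close>.\<close>
    also have "\<dots> \<le> (?K + 1) * (?x\<^sup>2 / ?K + ?y\<^sup>2)"
    proof -
      have "(?K + 1) * (?x\<^sup>2 / ?K + ?y\<^sup>2) - (?x + ?y)\<^sup>2 = (?x - ?K * ?y)\<^sup>2 / ?K"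
        by (simp add: field_simps power2_eq_square del: of_nat_Suc)
      also have "\<dots> \<ge> 0" by simp
      finally show ?thesis by simp
    qed
    also have "\<dots> \<le> (?K + 1) * (2 * gap u m + 2 * gap m v)"
    proof (intro mult_left_mono add_mono)
      have "?x\<^sup>2 \<le> ?K * (2 * gap u m)" using Suc.IH[of m] m Suc.prems by simp
      then show "?x\<^sup>2 / ?K \<le> 2 * gap u m" by (simp add: field_simps del: of_nat_Suc)
      show "?y\<^sup>2 \<le> 2 * gap m v" using short[of m v] m Suc.prems by (simp add: \<phi>_def)
    qed simp
    also have "\<dots> \<le> (?K + 1) * (2 * gap u v)"
      using gap_superadditive[of u m v] m Suc.prems by (intro mult_left_mono) auto
    finally show ?case by (simp add: add.commute)
  qed
  define k where "k = nat \<lfloor>(v - u) / \<delta>\<rfloor>"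
  have r: "(v - u) / \<delta> \<ge> 0" using \<delta> uv by simp
  have k: "(v - u) / \<delta> \<le> real (Suc k)" "real (Suc k) \<le> 1 + (v - u) / \<delta>"
    using r unfolding k_def by linarith+
  have "(max 0 (\<phi> u v))\<^sup>2 \<le> real (Suc k) * (2 * gap u v)"
    using k(1) \<delta> uv by (intro *) (auto simp: field_simps)
  also have "\<dots> \<le> (1 + (v - u) / \<delta>) * (2 * gap u v)"
    using k(2) gap_nonneg[OF uv] by (intro mult_right_mono) auto
  finally show ?thesis by (simp add: \<phi>_def)
qed

section \<open>The Stieltjes integral and the error of a lower sum\<close>

text \<open>The definition uses \<open>THE\<close>, so existence and uniqueness are both required.
  For existence, uniform continuity bounds the oscillation of \<open>f\<close> on each cell by
  \<open>e\<close>, and the increments of \<open>g\<close> sum to \<open>g b - g a\<close>.\<close>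

lemma RS_integral_eq: "RS_integral f g a b = integral {a..b} (\<lambda>s. f s * g' s)"
proof -
  let ?I = "integral {a..b} (\<lambda>s. f s * g' s)"
  have gba: "g a \<le> g b" using g_mono a_less_b by simp
  have ex: "has_RS_integral f g a b ?I"
    unfolding has_RS_integral_def
  proof (intro allI impI)
    fix \<epsilon> :: real assume "\<epsilon> > 0"
    \<comment> \<open>The summand 1 keeps the denominator positive and makes the final estimate
      strict.\<close>
    define e where "e = \<epsilon> / (1 + (g b - g a))"
    have e: "e > 0" "e * (g b - g a) < \<epsilon>"
      using \<open>\<epsilon> > 0\<close> gba by (auto simp: e_def field_simps)
    have "uniformly_continuous_on {a..b} f" by (intro compact_uniformly_continuous f_cont) auto
    then obtain d where d: "d > 0"
      "\<And>x y. \<lbrakk>x \<in> {a..b}; y \<in> {a..b}; dist y x < d\<rbrakk> \<Longrightarrow> dist (f y) (f x) < e"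
      using e unfolding uniformly_continuous_on_def by metis
    show "\<exists>\<delta>>0. \<forall>n t \<xi>. division a b n t \<and> mesh n t < \<delta> \<and> (\<forall>i\<in>{1..n}. \<xi> i \<in> {t (i - 1)..t i}) \<longrightarrow>
        \<bar>(\<Sum>i=1..n. f (\<xi> i) * (g (t i) - g (t (i - 1)))) - ?I\<bar> < \<epsilon>"
    proof (intro exI[of _ d] conjI allI impI d(1), elim conjE)
      fix n t \<xi>
      assume t: "division a b n t" "mesh n t < d" and \<xi>: "\<forall>i\<in>{1..n}. \<xi> i \<in> {t (i - 1)..t i}"
      let ?J = "\<lambda>u v. integral {u..v} (\<lambda>s. f s * g' s)"
      have cell: "\<bar>f (\<xi> i) * (g (t i) - g (t (i - 1))) - ?J (t (i - 1)) (t i)\<bar>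
          \<le> e * (g (t i) - g (t (i - 1)))" if i: "i \<in> {1..n}" for i
      proof -
        note c = division_cell[OF t(1) i]
        have G: "(g' has_integral g (t i) - g (t (i - 1))) {t (i - 1)..t i}"
          using c by (intro g'_integral) auto
        have J: "((\<lambda>s. f s * g' s) has_integral ?J (t (i - 1)) (t i)) {t (i - 1)..t i}"
          using c by (intro integrable_integral integrable_cell continuous_intros f_cont g'_cont) auto
        have close: "\<bar>f (\<xi> i) - f s\<bar> \<le> e" "g' s > 0" if "s \<in> {t (i - 1)..t i}" for s
        proof -
          have x: "\<xi> i \<in> {t (i - 1)..t i}" using \<xi> i by blast
          then have "\<bar>\<xi> i - s\<bar> < d"
            using that division_width_less[OF t i] unfolding atLeastAtMost_iff by linarith
          then show "\<bar>f (\<xi> i) - f s\<bar> \<le> e"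
            using d(2)[of s "\<xi> i"] x that c by (simp add: dist_real_def)
          show "g' s > 0" using that c by (intro g'_pos) auto
        qed
        have "f (\<xi> i) * (g (t i) - g (t (i - 1))) - ?J (t (i - 1)) (t i) \<le> e * (g (t i) - g (t (i - 1)))"
        proof (rule has_integral_le[OF has_integral_diff[OF has_integral_mult_right[OF G] J]
              has_integral_mult_right[OF G]])
          fix s assume "s \<in> {t (i - 1)..t i}"
          from mult_right_mono[of "f (\<xi> i) - f s" e "g' s"] close[OF this]
          show "f (\<xi> i) * g' s - f s * g' s \<le> e * g' s" by (auto simp: algebra_simps)
        qed
        moreover have "?J (t (i - 1)) (t i) - f (\<xi> i) * (g (t i) - g (t (i - 1))) \<le> e * (g (t i) - g (t (i - 1)))"
        proof (rule has_integral_le[OF has_integral_diff[OF J has_integral_mult_right[OF G]]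
              has_integral_mult_right[OF G]])
          fix s assume "s \<in> {t (i - 1)..t i}"
          from mult_right_mono[of "f s - f (\<xi> i)" e "g' s"] close[OF this]
          show "f s * g' s - f (\<xi> i) * g' s \<le> e * g' s" by (auto simp: algebra_simps)
        qed
        ultimately show ?thesis by linarith
      qed
      have "(\<Sum>i=1..n. ?J (t (i - 1)) (t i)) = ?I"
        by (rule sum_division_additive[OF t(1)])
          (auto intro!: integral_cells continuous_intros f_cont g'_cont)
      then have "\<bar>(\<Sum>i=1..n. f (\<xi> i) * (g (t i) - g (t (i - 1)))) - ?I\<bar> =
          \<bar>\<Sum>i=1..n. f (\<xi> i) * (g (t i) - g (t (i - 1))) - ?J (t (i - 1)) (t i)\<bar>"
        by (simp add: sum_subtractf)
      also have "\<dots> \<le> (\<Sum>i=1..n. e * (g (t i) - g (t (i - 1))))"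
        using cell by (intro order_trans[OF sum_abs] sum_mono) auto
      also have "\<dots> = e * (g b - g a)"
        by (rule sum_division_additive[OF t(1)]) (auto simp: algebra_simps)
      finally show "\<bar>(\<Sum>i=1..n. f (\<xi> i) * (g (t i) - g (t (i - 1)))) - ?I\<bar> < \<epsilon>" using e by simp
    qed
  qed
  \<comment> \<open>On a sufficiently fine division, a single Riemann sum would lie within half the
    distance between two distinct values of each of them.\<close>
  have unique: "J = ?I" if J: "has_RS_integral f g a b J" for J
  proof (rule ccontr)
    assume "J \<noteq> ?I"
    then have e: "\<bar>J - ?I\<bar> / 2 > 0" by simp
    obtain d1 where d1: "d1 > 0" "\<And>n t \<xi>. division a b n t \<and> mesh n t < d1 \<and>
        (\<forall>i\<in>{1..n}. \<xi> i \<in> {t (i - 1)..t i}) \<Longrightarrow>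
        \<bar>(\<Sum>i=1..n. f (\<xi> i) * (g (t i) - g (t (i - 1)))) - J\<bar> < \<bar>J - ?I\<bar> / 2"
      using J e unfolding has_RS_integral_def by meson
    obtain d2 where d2: "d2 > 0" "\<And>n t \<xi>. division a b n t \<and> mesh n t < d2 \<and>
        (\<forall>i\<in>{1..n}. \<xi> i \<in> {t (i - 1)..t i}) \<Longrightarrow>
        \<bar>(\<Sum>i=1..n. f (\<xi> i) * (g (t i) - g (t (i - 1)))) - ?I\<bar> < \<bar>J - ?I\<bar> / 2"
      using ex e unfolding has_RS_integral_def by meson
    obtain n t where t: "division a b n t" "mesh n t < min d1 d2"
      using exists_fine_division[OF a_less_b, of "min d1 d2"] d1(1) d2(1) by auto
    have "\<forall>i\<in>{1..n}. t i \<in> {t (i - 1)..t i}"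
      using division_cell(2)[OF t(1)] by (auto intro: less_imp_le)
    then have "\<bar>(\<Sum>i=1..n. f (t i) * (g (t i) - g (t (i - 1)))) - J\<bar> < \<bar>J - ?I\<bar> / 2"
      "\<bar>(\<Sum>i=1..n. f (t i) * (g (t i) - g (t (i - 1)))) - ?I\<bar> < \<bar>J - ?I\<bar> / 2"
      using d1(2)[of n t t] d2(2)[of n t t] t by auto
    then show False by (auto simp: abs_if split: if_splits)
  qed
  show ?thesis unfolding RS_integral_def using ex unique by (rule the_equality)
qed

lemma RS_integral_minus_lower_sum:
  assumes "division a b n t"
  shows "RS_integral f g a b - lower_RS_sum f g n t = (\<Sum>i=1..n. gap (t (i - 1)) (t i))"
proof -
  have "(\<Sum>i=1..n. integral {t (i - 1)..t i} (\<lambda>s. f s * g' s)) = integral {a..b} (\<lambda>s. f s * g' s)"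
    by (rule sum_division_additive[OF assms])
      (auto intro!: integral_cells continuous_intros f_cont g'_cont)
  then show ?thesis
    by (simp add: RS_integral_eq lower_RS_sum_def gap_def cell_min_def sum_subtractf)
qed

lemma sum_integral_h:
  assumes "division a b n t"
  shows "(\<Sum>i=1..n. integral {t (i - 1)..t i} h - \<eta> * (t i - t (i - 1))) =
    integral {a..b} h - \<eta> * (b - a)"
proof (rule sum_division_additive[OF assms])
  fix u v w assume "a \<le> u" "u \<le> v" "v \<le> w" "w \<le> b"
  from integral_cells[OF h_cont this]
  show "integral {u..w} h - \<eta> * (w - u) =
      integral {u..v} h - \<eta> * (v - u) + (integral {v..w} h - \<eta> * (w - v))"
    by (simp add: algebra_simps)
qed simp

section \<open>Lower bound for the error of every division\<close>

text \<open>Cauchy-Schwarz over the cells, with the factors of \<open>gap_long_cell\<close> as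
  weights. \<open>N\<close> is chosen before \<open>n\<close> and the division, so it disappears in
  the limit.\<close>

lemma error_lower_bound:
  assumes "\<eta> > 0"
  obtains N where "N > 0" "\<And>n t. \<lbrakk>n \<ge> 1; division a b n t\<rbrakk> \<Longrightarrow>
    (max 0 (integral {a..b} h - \<eta> * (b - a)))\<^sup>2
      \<le> (real n + N) * (2 * (RS_integral f g a b - lower_RS_sum f g n t))"
proof -
  obtain \<delta> where \<delta>: "\<delta> > 0"
    "\<And>u v. \<lbrakk>a \<le> u; u \<le> v; v \<le> b; v - u \<le> \<delta>\<rbrakk> \<Longrightarrow>
       (max 0 (integral {u..v} h - \<eta> * (v - u)))\<^sup>2 \<le> 2 * gap u v"
    using gap_short_cell[OF assms] by metis
  show ?thesis
  proof (rule that[of "(b - a) / \<delta>"])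
    show "(b - a) / \<delta> > 0" using \<delta> a_less_b by simp
    fix n t assume n: "n \<ge> 1" and t: "division a b n t"
    define x where "x i = max 0 (integral {t (i - 1)..t i} h - \<eta> * (t i - t (i - 1)))" for i
    define k where "k i = 1 + (t i - t (i - 1)) / \<delta>" for i
    define e where "e i = 2 * gap (t (i - 1)) (t i)" for i
    have cell: "(x i)\<^sup>2 \<le> k i * e i" "k i \<ge> 0" "e i \<ge> 0" "x i \<ge> 0" if i: "i \<in> {1..n}" for i
    proof -
      note c = division_cell[OF t i]
      show "(x i)\<^sup>2 \<le> k i * e i"
        unfolding x_def k_def e_def using c by (intro gap_long_cell \<delta>) auto
      show "k i \<ge> 0" unfolding k_def using c \<delta>(1) by simp
      show "e i \<ge> 0" unfolding e_def using gap_nonneg c by auto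
    qed (simp add: x_def)
    \<comment> \<open>Truncating each cell term at 0 can only raise it.\<close>
    have "integral {a..b} h - \<eta> * (b - a) \<le> (\<Sum>i=1..n. x i)"
      unfolding sum_integral_h[OF t, symmetric] x_def by (intro sum_mono) auto
    moreover have "(\<Sum>i=1..n. x i) \<ge> 0" using cell by (intro sum_nonneg) auto
    ultimately have "(max 0 (integral {a..b} h - \<eta> * (b - a)))\<^sup>2 \<le> (\<Sum>i=1..n. x i)\<^sup>2"
      by (intro power_mono) auto
    also have "\<dots> \<le> (\<Sum>i=1..n. sqrt (k i) * sqrt (e i))\<^sup>2"
      using cell by (intro power_mono sum_mono sum_nonneg)
        (auto simp: real_sqrt_mult[symmetric] intro: real_le_rsqrt)
    also have "\<dots> \<le> (\<Sum>i=1..n. (sqrt (k i))\<^sup>2) * (\<Sum>i=1..n. (sqrt (e i))\<^sup>2)"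
      by (rule Cauchy_Schwarz_ineq_sum)
    also have "\<dots> = (\<Sum>i=1..n. k i) * (\<Sum>i=1..n. e i)"
      using cell by (auto intro!: arg_cong2[of _ _ _ _ "(*)"] sum.cong)
    \<comment> \<open>The widths add up to \<open>b - a\<close> for every division, so the total
      surcharge for long cells is bounded.\<close>
    also have "(\<Sum>i=1..n. k i) = real n + (b - a) / \<delta>"
      unfolding k_def sum.distrib
      by (subst sum_division_additive[OF t]) (auto simp: add_divide_distrib[symmetric])
    also have "(\<Sum>i=1..n. e i) = 2 * (RS_integral f g a b - lower_RS_sum f g n t)"
      by (simp add: RS_integral_minus_lower_sum[OF t] e_def sum_distrib_left)
    finally show "(max 0 (integral {a..b} h - \<eta> * (b - a)))\<^sup>2
        \<le> (real n + (b - a) / \<delta>) * (2 * (RS_integral f g a b - lower_RS_sum f g n t))" .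
  qed
qed

section \<open>Upper bound from an equidistributing division\<close>

text \<open>Equidistributing \<^term>\<open>\<lambda>x. h x + \<eta>\<close> instead of \<^term>\<open>h\<close> forces the mesh to tend to \<open>0\<close>
  even where \<^term>\<open>f'\<close> vanishes.\<close>

lemma equidistributing_division:
  assumes \<eta>: "\<eta> > 0" and n: "n \<ge> 1"
  obtains t where "division a b n t"
    "\<And>i. i \<in> {1..n} \<Longrightarrow> integral {t (i - 1)..t i} h + \<eta> * (t i - t (i - 1)) =
       (integral {a..b} h + \<eta> * (b - a)) / real n"
proof -
  \<comment> \<open>Since \<open>\<eta> > 0\<close>, \<open>H\<close> increases strictly even where
    \<open>h\<close> vanishes. The division points are the preimages of \<open>n + 1\<close> equally
    spaced levels from 0 to \<open>H b\<close>.\<close>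
  define H where "H x = integral {a..x} h + \<eta> * (x - a)" for x
  have H_cont: "continuous_on {a..b} H"
    unfolding H_def[abs_def]
    by (intro continuous_intros indefinite_integral_continuous_1 integrable_cell[OF h_cont]) auto
  have H_diff: "H v - H u = integral {u..v} h + \<eta> * (v - u)"
    if "a \<le> u" "u \<le> v" "v \<le> b" for u v
    using integral_cells[OF h_cont, of a u v] that by (simp add: H_def algebra_simps)
  have H_less: "H u < H v" if "a \<le> u" "u < v" "v \<le> b" for u v
  proof -
    have "integral {u..v} h \<ge> 0"
      using that h_nonneg by (intro Henstock_Kurzweil_Integration.integral_nonneg integrable_cell[OF h_cont]) auto
    moreover have "\<eta> * (v - u) > 0" using \<eta> that by simp
    ultimately show ?thesis using H_diff[of u v] that by simp
  qed
  have Ha: "H a = 0" by (simp add: H_def)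
  have Hb: "H b > 0" using H_less[of a b] a_less_b Ha by simp
  have "\<exists>x. a \<le> x \<and> x \<le> b \<and> H x = real i * H b / real n" if "i \<le> n" for i
  proof (rule IVT')
    show "H a \<le> real i * H b / real n" using Ha Hb by simp
    show "real i * H b / real n \<le> H b" using that n Hb by (simp add: field_simps)
  qed (use a_less_b H_cont in auto)
  then obtain t where t: "\<And>i. i \<le> n \<Longrightarrow> a \<le> t i \<and> t i \<le> b \<and> H (t i) = real i * H b / real n"
    by metis
  have H_less_iff: "u < v" if "H u < H v" "a \<le> u" "u \<le> b" "a \<le> v" "v \<le> b" for u v
    using H_less[of v u] that by (cases u v rule: linorder_cases) auto
  have H_inj: "u = v" if "H u = H v" "a \<le> u" "u \<le> b" "a \<le> v" "v \<le> b" for u v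
    using H_less[of v u] H_less[of u v] that by (cases u v rule: linorder_cases) auto
  have step: "t (i - 1) < t i" if "i \<in> {1..n}" for i
  proof (rule H_less_iff)
    have "real (i - 1) * H b / real n < real i * H b / real n"
      using that Hb by (intro divide_strict_right_mono mult_strict_right_mono) auto
    then show "H (t (i - 1)) < H (t i)" using t[of i] t[of "i - 1"] that by auto
  qed (use t[of i] t[of "i - 1"] that in auto)
  show ?thesis
  proof (rule that[of t])
    \<comment> \<open>The intermediate value theorem only supplies some preimages; injectivity of
      \<open>H\<close> identifies the outermost ones as \<open>a\<close> and
      \<open>b\<close>.\<close>
    have "t 0 = a" using H_inj[of "t 0" a] t[of 0] Ha a_less_b by simp
    moreover have "t n = b" using H_inj[of "t n" b] t[of n] n a_less_b by simp
    ultimately show "division a b n t" using step by (simp add: division_def)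
    fix i assume i: "i \<in> {1..n}"
    then have "i \<le> n" "i - 1 \<le> n" by auto
    note ti = t[OF this(1)] t[OF this(2)]
    have "real i * H b / real n - real (i - 1) * H b / real n = H b / real n"
      using i by (cases i) (auto simp: distrib_right add_divide_distrib)
    then have "H (t i) - H (t (i - 1)) = H b / real n" using ti by metis
    moreover have "H (t i) - H (t (i - 1)) = integral {t (i - 1)..t i} h + \<eta> * (t i - t (i - 1))"
      using ti step[OF i] by (meson H_diff less_imp_le)
    ultimately show "integral {t (i - 1)..t i} h + \<eta> * (t i - t (i - 1)) =
       (integral {a..b} h + \<eta> * (b - a)) / real n" unfolding H_def by metis
  qed
qed

text \<open>On the equidistributing division each of the \<open>n\<close> cells has gap at most
  \<open>(?K / n)^2 / 2\<close>, once \<open>n\<close> is large enough for all cells to be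
  short.\<close>

lemma error_upper_bound:
  assumes \<eta>: "\<eta> > 0"
  shows "\<forall>\<^sub>F n in sequentially. \<exists>t. division a b n t \<and>
    real n * (RS_integral f g a b - lower_RS_sum f g n t) \<le> (integral {a..b} h + \<eta> * (b - a))\<^sup>2 / 2"
proof -
  let ?K = "integral {a..b} h + \<eta> * (b - a)"
  obtain \<delta> where \<delta>: "\<delta> > 0"
    "\<And>u v. \<lbrakk>a \<le> u; u \<le> v; v \<le> b; v - u \<le> \<delta>\<rbrakk> \<Longrightarrow>
       2 * gap u v \<le> (integral {u..v} h + \<eta> * (v - u))\<^sup>2"
    using gap_short_cell[OF \<eta>] by metis
  \<comment> \<open>As the integral of \<open>h\<close> is nonnegative, a cell has width at most
    \<open>?K / (n * \<eta>)\<close>; beyond \<open>m\<close> this is at most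
    \<open>\<delta>\<close>.\<close>
  obtain m :: nat where m: "?K / (\<eta> * \<delta>) < real m" using reals_Archimedean2 by blast
  show ?thesis
    unfolding eventually_sequentially
  proof (intro exI[of _ "Suc m"] allI impI)
    fix n assume "Suc m \<le> n"
    then have n: "n \<ge> 1" and nK: "?K / (\<eta> * \<delta>) < real n" using m by auto
    obtain t where t: "division a b n t" "\<And>i. i \<in> {1..n} \<Longrightarrow>
        integral {t (i - 1)..t i} h + \<eta> * (t i - t (i - 1)) = ?K / real n"
      using equidistributing_division[OF \<eta> n] by blast
    have cell: "gap (t (i - 1)) (t i) \<le> (?K / real n)\<^sup>2 / 2" if i: "i \<in> {1..n}" for i
    proof -
      note c = division_cell[OF t(1) i]
      have "integral {t (i - 1)..t i} h \<ge> 0"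
        using c h_nonneg
        by (intro Henstock_Kurzweil_Integration.integral_nonneg integrable_cell[OF h_cont]) auto
      then have "\<eta> * (t i - t (i - 1)) \<le> ?K / real n" using t(2)[OF i] by simp
      also have "\<dots> \<le> \<eta> * \<delta>" using nK \<eta> \<delta>(1) n by (simp add: field_simps)
      finally have "t i - t (i - 1) \<le> \<delta>" using \<eta> by simp
      then show ?thesis using \<delta>(2)[of "t (i - 1)" "t i"] c t(2)[OF i] by simp
    qed
    have "real n * (\<Sum>i=1..n. gap (t (i - 1)) (t i)) \<le> real n * (\<Sum>i=1..n. (?K / real n)\<^sup>2 / 2)"
      using cell by (intro mult_left_mono sum_mono) auto
    also have "\<dots> = ?K\<^sup>2 / 2" using n by (simp add: power2_eq_square)
    finally show "\<exists>t. division a b n t \<and>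
        real n * (RS_integral f g a b - lower_RS_sum f g n t) \<le> ?K\<^sup>2 / 2"
      using t(1) RS_integral_minus_lower_sum[OF t(1)] by metis
  qed
qed

section \<open>Passage to the limit\<close>

text \<open>The lower bound holds for every division, hence for the optimal one; the upper bound
  passes from the equidistributing division by optimality. In both halves \<open>\<eta>\<close> is
  fixed before \<open>n\<close> grows, using the strict room between \<open>y\<close> and the
  limit.\<close>

lemma optimal_error_limit:
  assumes opt: "\<And>n. n \<ge> 1 \<Longrightarrow> optimal_division f g a b n (D n)"
  shows "(\<lambda>n. real n * (RS_integral f g a b - lower_RS_sum f g n (D n)))
    \<longlonglongrightarrow> (integral {a..b} h)\<^sup>2 / 2"
proof (rule order_tendstoI)
  let ?K = "integral {a..b} h"
  let ?E = "\<lambda>n. RS_integral f g a b - lower_RS_sum f g n (D n)"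
  have K0: "?K \<ge> 0"
    using h_nonneg by (intro Henstock_Kurzweil_Integration.integral_nonneg integrable_cell[OF h_cont]) auto
  fix y assume y: "y < ?K\<^sup>2 / 2"
  \<comment> \<open>At \<open>\<eta> = 0\<close> the truncation is inactive because
    \<open>?K\<close> is nonnegative.\<close>
  have "((\<lambda>\<eta>. (max 0 (?K - \<eta> * (b - a)))\<^sup>2 / 2) \<longlongrightarrow> (max 0 (?K - 0 * (b - a)))\<^sup>2 / 2) (at_right 0)"
    by (intro tendsto_intros) auto
  then have "\<forall>\<^sub>F \<eta> in at_right 0. y < (max 0 (?K - \<eta> * (b - a)))\<^sup>2 / 2"
    by (rule order_tendstoD) (use y K0 in simp)
  then obtain \<eta> where \<eta>: "\<eta> > 0" "y < (max 0 (?K - \<eta> * (b - a)))\<^sup>2 / 2"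
    by (metis (mono_tags, lifting) eventually_at_right_field dense)
  define c where "c = (max 0 (?K - \<eta> * (b - a)))\<^sup>2 / 2"
  obtain N where N: "N > 0" "\<And>n t. \<lbrakk>n \<ge> 1; division a b n t\<rbrakk> \<Longrightarrow>
      2 * c \<le> (real n + N) * (2 * (RS_integral f g a b - lower_RS_sum f g n t))"
    using error_lower_bound[OF \<eta>(1)] unfolding c_def by auto
  have "(\<lambda>n. real n / (real n + N) * c) \<longlonglongrightarrow> 1 * c"
    by (intro tendsto_intros) real_asymp
  then have "\<forall>\<^sub>F n in sequentially. y < real n / (real n + N) * c"
    by (rule order_tendstoD) (use \<eta> in \<open>simp add: c_def\<close>)
  then show "\<forall>\<^sub>F n in sequentially. y < real n * ?E n"
    \<comment> \<open>As \<open>a < b\<close> there is no division into 0 cells, so optimality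
      starts at \<open>n = 1\<close>.\<close>
    using eventually_ge_at_top[of 1]
  proof eventually_elim
    case (elim n)
    have "c \<le> (real n + N) * ?E n"
      using N(2)[of n "D n"] opt[of n] elim by (simp add: optimal_division_def algebra_simps)
    then have "real n * (c / (real n + N)) \<le> real n * ?E n"
      using N(1) by (intro mult_left_mono) (auto simp: field_simps)
    with elim show ?case by simp
  qed
next
  let ?K = "integral {a..b} h"
  fix y assume y: "?K\<^sup>2 / 2 < y"
  have "((\<lambda>\<eta>. (?K + \<eta> * (b - a))\<^sup>2 / 2) \<longlongrightarrow> (?K + 0 * (b - a))\<^sup>2 / 2) (at_right 0)"
    by (intro tendsto_intros) auto
  then have "\<forall>\<^sub>F \<eta> in at_right 0. (?K + \<eta> * (b - a))\<^sup>2 / 2 < y"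
    by (rule order_tendstoD) (use y in simp)
  then obtain \<eta> where \<eta>: "\<eta> > 0" "(?K + \<eta> * (b - a))\<^sup>2 / 2 < y"
    by (metis (mono_tags, lifting) eventually_at_right_field dense)
  from error_upper_bound[OF \<eta>(1)] eventually_ge_at_top[of 1]
  show "\<forall>\<^sub>F n in sequentially. real n * (RS_integral f g a b - lower_RS_sum f g n (D n)) < y"
  proof eventually_elim
    case (elim n)
    then obtain t where t: "division a b n t"
      "real n * (RS_integral f g a b - lower_RS_sum f g n t) \<le> (?K + \<eta> * (b - a))\<^sup>2 / 2"
      by blast
    have "lower_RS_sum f g n t \<le> lower_RS_sum f g n (D n)"
      using opt[of n] elim t(1) by (simp add: optimal_division_def)
    then have "real n * (RS_integral f g a b - lower_RS_sum f g n (D n))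
        \<le> real n * (RS_integral f g a b - lower_RS_sum f g n t)"
      by (intro mult_left_mono) auto
    with t(2) \<eta>(2) show ?case by linarith
  qed
qed

end

theorem theorem6:
  fixes a b :: real
    and f f' g g' :: "real \<Rightarrow> real"
    and \<Delta>opt :: "nat \<Rightarrow> nat \<Rightarrow> real"
  assumes "a < b"
    and "\<And>x. x \<in> {a..b} \<Longrightarrow> (f has_real_derivative f' x) (at x within {a..b})"
    and "continuous_on {a..b} f'"
    and "finite {x \<in> {a..b}. f' x = 0}"
    and "\<And>x. x \<in> {a..b} \<Longrightarrow> (g has_real_derivative g' x) (at x within {a..b})"
    and "continuous_on {a..b} g'"
    and "\<And>x. x \<in> {a..b} \<Longrightarrow> g' x > 0"
    and "\<And>n. n \<ge> 1 \<Longrightarrow> optimal_division f g a b n (\<Delta>opt n)"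
  shows "(\<lambda>n. real n * (RS_integral f g a b - lower_RS_sum f g n (\<Delta>opt n)))
           \<longlonglongrightarrow> (1 / 2) * (integral {a..b} (\<lambda>t. sqrt (\<bar>f' t\<bar> * g' t)))\<^sup>2"
proof -
  interpret C1_pair a b f f' g g' by unfold_locales (fact assms)+
  show ?thesis using optimal_error_limit[OF assms(8)] by (simp add: h_def[abs_def])
qed

end
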